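(* For every $n\ge 3$, the cycle graph $C_n$ has a canonical ESD labeling.
   Context: For a graph $G=(V,E)$ and $l\in\mathbb N$, a vertex labeling $\phi:V\to\{1,\dots,l\}$ is an edge-sum distinguishing (ESD) labeling if $\phi$ is injective and the edge-weights $w_\phi(uv)=\phi(u)+\phi(v)$ are pairwise distinct over all edges $uv\in E$. It is a canonical ESD labeling if $l=|V|$. *)

theory Defs
  imports "HOL-Library.FuncSet"
begin

text \<open>A graph is a pair of a vertex set and a set of edges, an edge being the
  two-element set of its endpoints.\<close>

type_synonym 'a graph = "'a set \<times> 'a set set"

abbreviation verts :: "'a graph \<Rightarrow> 'a set" where
  "verts G \<equiv> fst G"

abbreviation edges :: "'a graph \<Rightarrow> 'a set set" where
  "edges G \<equiv> snd G"

definition simple_graph :: "'a graph \<Rightarrow> bool" where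
  "simple_graph G \<longleftrightarrow>
     finite (verts G) \<and>
     (\<forall>e \<in> edges G. \<exists>u v. e = {u, v} \<and> u \<noteq> v \<and> u \<in> verts G \<and> v \<in> verts G)"

definition edge_weight :: "('a \<Rightarrow> nat) \<Rightarrow> 'a \<Rightarrow> 'a \<Rightarrow> nat" where
  "edge_weight \<phi> u v = \<phi> u + \<phi> v"

definition esd_labeling :: "'a graph \<Rightarrow> nat \<Rightarrow> ('a \<Rightarrow> nat) \<Rightarrow> bool" where
  "esd_labeling G l \<phi> \<longleftrightarrow>
     \<phi> \<in> verts G \<rightarrow> {1..l} \<and>
     inj_on \<phi> (verts G) \<and>
     (\<forall>u v x y. {u, v} \<in> edges G \<longrightarrow> {x, y} \<in> edges G \<longrightarrow> {u, v} \<noteq> {x, y} \<longrightarrow>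
        edge_weight \<phi> u v \<noteq> edge_weight \<phi> x y)"

definition canonical_esd_labeling :: "'a graph \<Rightarrow> ('a \<Rightarrow> nat) \<Rightarrow> bool" where
  "canonical_esd_labeling G \<phi> \<longleftrightarrow> esd_labeling G (card (verts G)) \<phi>"

text \<open>Only meaningful as a simple graph for \<open>n \<ge> 3\<close>: there is a loop for \<open>n = 1\<close>,
  and the two edges coincide for \<open>n = 2\<close>.\<close>

definition cycle_graph :: "nat \<Rightarrow> nat graph" where
  "cycle_graph n = ({0..<n}, {{i, (i + 1) mod n} | i. i < n})"

lemma simple_graph_cycle_graph:
  assumes "n \<ge> 3"
  shows "simple_graph (cycle_graph n)"
proof -
  have "i \<noteq> (i + 1) mod n" "(i + 1) mod n < n" if "i < n" for i
    using that assms by (auto simp: mod_Suc)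
  then show ?thesis
    unfolding simple_graph_def cycle_graph_def by fastforce
qed

lemma card_edges_cycle_graph:
  assumes "n \<ge> 3"
  shows "card (edges (cycle_graph n)) = n"
proof -
  have "inj_on (\<lambda>i. {i, (i + 1) mod n}) {0..<n}"
    using assms by (auto simp: inj_on_def doubleton_eq_iff mod_Suc split: if_splits)
  moreover have "edges (cycle_graph n) = (\<lambda>i. {i, (i + 1) mod n}) ` {0..<n}"
    by (auto simp: cycle_graph_def)
  ultimately show ?thesis
    by (simp add: card_image)
qed

end

theory Submission
  imports Defs
begin

text \<open>Every edge comes from some index \<open>i < n\<close>, and distinct edges have distinct
  indices, so injectivity of the weight in the index suffices.\<close>

lemma canonical_esd_labeling_cycle_graphI:
  assumes "\<phi> \<in> {0..<n} \<rightarrow> {1..n}"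
    and "inj_on \<phi> {0..<n}"
    and weights: "inj_on (\<lambda>i. edge_weight \<phi> i ((i + 1) mod n)) {0..<n}"
  shows "canonical_esd_labeling (cycle_graph n) \<phi>"
proof -
  \<comment> \<open>\<open>u\<close>, \<open>v\<close> may list the endpoints in either order; the
    weight is symmetric.\<close>
  have index: "\<exists>i<n. {u, v} = {i, (i + 1) mod n} \<and>
      edge_weight \<phi> u v = edge_weight \<phi> i ((i + 1) mod n)"
    if "{u, v} \<in> edges (cycle_graph n)" for u v
    using that
    by (fastforce simp: cycle_graph_def edge_weight_def doubleton_eq_iff)
  have "edge_weight \<phi> u v \<noteq> edge_weight \<phi> x y"
    if uv: "{u, v} \<in> edges (cycle_graph n)" and xy: "{x, y} \<in> edges (cycle_graph n)"
      and "{u, v} \<noteq> {x, y}" for u v x y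
  proof -
    obtain i where i: "i < n" "{u, v} = {i, (i + 1) mod n}"
      "edge_weight \<phi> u v = edge_weight \<phi> i ((i + 1) mod n)"
      using index[OF uv] by blast
    obtain j where j: "j < n" "{x, y} = {j, (j + 1) mod n}"
      "edge_weight \<phi> x y = edge_weight \<phi> j ((j + 1) mod n)"
      using index[OF xy] by blast
    have "i \<noteq> j"
      using i(2) j(2) that(3) by auto
    then show ?thesis
      using inj_onD[OF weights, of i j] i(1,3) j(1,3) by auto
  qed
  then show ?thesis
    using assms(1,2)
    by (simp add: canonical_esd_labeling_def esd_labeling_def cycle_graph_def)
qed

text \<open>Turns \<open>mod\<close> into a case split, leaving linear arithmetic. The form
  \<open>Suc i\<close> matches what simp makes of \<open>i + 1\<close>.\<close>

lemma Suc_mod_if: "Suc i mod n = (if Suc i = n then 0 else Suc i)" if "i < n"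
  using that by (simp add: mod_Suc)

text \<open>For odd \<open>n\<close>, label consecutively: the weights are \<open>3, 5, \<dots>, 2n - 1\<close> and the even
  closing weight \<open>n + 1\<close>. For even \<open>n\<close> the closing weight would be odd; exchanging the labels
  1 and 2 gives \<open>3, 4, 7, 9, \<dots>, 2n - 1\<close> and the closing weight \<open>n + 2\<close>, which is even and
  larger than 4.\<close>

theorem theorem6:
  fixes n :: nat
  assumes "n \<ge> 3"
  shows "\<exists>\<phi> :: nat \<Rightarrow> nat. canonical_esd_labeling (cycle_graph n) \<phi>"
proof (cases "odd n")
  case True
  have "inj_on (\<lambda>i. edge_weight Suc i ((i + 1) mod n)) {0..<n}"
  proof (rule inj_onI)
    fix i j
    assume "i \<in> {0..<n}" "j \<in> {0..<n}"
      and "edge_weight Suc i ((i + 1) mod n) = edge_weight Suc j ((j + 1) mod n)"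
    \<comment> \<open>Non-closing weights \<open>2 * i + 3\<close> are odd and strictly increasing,
      so none equals the even \<open>n + 1\<close>.\<close>
    then show "i = j"
      using True by (auto simp: edge_weight_def Suc_mod_if split: if_splits)
  qed
  then have "canonical_esd_labeling (cycle_graph n) Suc"
    by (intro canonical_esd_labeling_cycle_graphI) auto
  then show ?thesis by (rule exI[of _ Suc])
next
  case False
  define \<phi> :: "nat \<Rightarrow> nat" where
    "\<phi> i = (if i = 0 then 2 else if i = 1 then 1 else Suc i)" for i
  \<comment> \<open>Since \<open>n \<ge> 3\<close>, neither 0 nor 1 is the closing index
    \<open>n - 1\<close>, so the cases do not overlap.\<close>
  have weight: "edge_weight \<phi> i ((i + 1) mod n) =
      (if i = 0 then 3 else if i = 1 then 4 else if Suc i = n then n + 2 else 2 * i + 3)"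
    if "i < n" for i
    using that assms by (auto simp: edge_weight_def \<phi>_def Suc_mod_if)
  have "inj_on (\<lambda>i. edge_weight \<phi> i ((i + 1) mod n)) {0..<n}"
  proof (rule inj_onI)
    fix i j
    assume "i \<in> {0..<n}" "j \<in> {0..<n}"
      and "edge_weight \<phi> i ((i + 1) mod n) = edge_weight \<phi> j ((j + 1) mod n)"
    then have "i < n" "j < n"
      "(if i = 0 then 3 else if i = 1 then 4 else if Suc i = n then n + 2 else 2 * i + 3) =
       (if j = 0 then 3 else if j = 1 then 4 else if Suc j = n then n + 2 else 2 * j + 3)"
      using weight by auto
    \<comment> \<open>Parity separates 3 and \<open>2 * i + 3\<close> from 4 and
      \<open>n + 2\<close>; within each class size decides, as \<open>2 * i + 3 \<ge> 7\<close> for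
      \<open>i \<ge> 2\<close>.\<close>
    then show "i = j"
      using False assms by (auto split: if_splits)
  qed
  moreover have "\<phi> \<in> {0..<n} \<rightarrow> {1..n}" "inj_on \<phi> {0..<n}"
    using assms by (auto simp: \<phi>_def inj_on_def)
  ultimately have "canonical_esd_labeling (cycle_graph n) \<phi>"
    by (intro canonical_esd_labeling_cycle_graphI)
  then show ?thesis by (rule exI[of _ \<phi>])
qed

end
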